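(* In the setting of the context, let $\|\cdot\|_{e,*}$ and $\|\cdot\|_{e,*,i}$ ($i\in\beth$) be alternate norms on $\mathcal B^*$ and $\mathcal B_i^*$, and let $C_e\ge1$ be a constant such that $C_e^{-1}\|\cdot\|_{e,*}\le\|\cdot\|_*\le C_e\|\cdot\|_{e,*}$ and $C_e^{-1}\|\cdot\|_{e,*,i}\le\|\cdot\|_{*,i}\le C_e\|\cdot\|_{e,*,i}$ for $i\in\beth$. Let $C_{\min}$ and $C_{\max}$ be (positive) constants such that for all $\varphi\in\mathcal B^*$, $$C_{\min}\inf_{\phi\in\Phi}\|\varphi-\phi\|_{e,*}^2\le\sum_{i\in\beth}\inf_{\phi\in\Phi}\|\mathcal R_i(\varphi-\phi)\|_{e,*,i}^2\le C_{\max}\inf_{\phi\in\Phi}\|\varphi-\phi\|_{e,*}^2.$$ Then $\lambda_{\max}(P)\le C_e^4C_{\max}$ and $\lambda_{\min}(P)\ge C_e^{-4}C_{\min}$.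
   Context: $(\mathcal B,\|\cdot\|)$ is a reflexive separable Banach space with dual $\mathcal B^*$ and pairing $[\cdot,\cdot]$, with $\|u\|^2=[Q^{-1}u,u]$ for a symmetric positive bijective linear operator $Q:\mathcal B^*\to\mathcal B$, $\langle u,v\rangle:=[Q^{-1}u,v]$, and dual norm $\|\phi\|_*=[\phi,Q\phi]^{1/2}$. $\aleph=\{1,\dots,|\aleph|\}$ and $\beth=\{1,\dots,|\beth|\}$ are finite index sets, $(\phi_{i,\alpha})_{(i,\alpha)\in\beth\times\aleph}$ are linearly independent elements of $\mathcal B^*$, with span $\Phi$. For $i\in\beth$, $\mathcal B_i\subset\mathcal B$ are closed subspaces with the induced norm $\|\cdot\|_i$ such that (1) $\mathcal B=\mathcal B_1+\cdots+\mathcal B_{|\beth|}$ (not necessarily direct) and (2) for each $(i,\alpha)$ there is $\tilde\psi_{i,\alpha}\in\mathcal B_i$ with $[\phi_{j,\beta},\tilde\psi_{i,\alpha}]=\delta_{i,j}\delta_{\alpha,\beta}$ for all $(j,\beta)$. $\mathfrak V^\perp:=\{\psi\in\mathcal B:[\phi_{i,\alpha},\psi]=0\ \forall(i,\alpha)\}$, $\mathfrak V^\perp_i:=\mathcal B_i\cap\mathfrak V^\perp$; $P_i$ is the $\langle\cdot,\cdot\rangle$-orthogonal projection of $\mathcal B$ onto $\mathfrak V^\perp_i$, $P:=\sum_{i\in\beth}P_i$. $\lambda_{\min}(P)$ and $\lambda_{\max}(P)$ are the largest and smallest constants with $\lambda_{\min}(P)\|\chi\|^2\le\langle\chi,P\chi\rangle\le\lambda_{\max}(P)\|\chi\|^2$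 for all $\chi\in\mathfrak V^\perp$. $\|\varphi\|_{*,i}:=\sup_{\psi\in\mathcal B_i}[\varphi,\psi]/\|\psi\|_i$ is the dual norm on $\mathcal B_i^*$; $\mathcal R_i:\mathcal B^*\to\mathcal B_i^*$ is restriction: $[\mathcal R_i\varphi,\psi]=[\varphi,\psi]$ for $\psi\in\mathcal B_i$. *)

theory Defs
  imports "HOL-Analysis.Analysis"
begin

text \<open>
  \<open>\<B>\<close> is a Banach space type \<open>'a\<close>, its dual is \<open>'a \<Rightarrow>\<^sub>L real\<close>, and the pairing
  \<open>[\<phi>, u]\<close> is application of \<open>\<phi>\<close> to \<open>u\<close>. The Hilbert structure is not taken from a type class:
  it is given by \<open>Q\<close>.
\<close>

definition reflexive_space :: "'a::banach itself \<Rightarrow> bool" where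
  "reflexive_space _ \<longleftrightarrow>
     (\<forall>F :: ('a \<Rightarrow>\<^sub>L real) \<Rightarrow>\<^sub>L real. \<exists>u :: 'a. \<forall>\<phi>. blinfun_apply F \<phi> = blinfun_apply \<phi> u)"

definition symmetric_op :: "(('a::banach \<Rightarrow>\<^sub>L real) \<Rightarrow> 'a) \<Rightarrow> bool" where
  "symmetric_op Q \<longleftrightarrow> (\<forall>\<phi> \<psi>. blinfun_apply \<phi> (Q \<psi>) = blinfun_apply \<psi> (Q \<phi>))"

text \<open>Definiteness of \<open>Q\<close> is not part of positivity here; it follows when
  \<open>\<parallel>u\<parallel>\<^sup>2 = [Q\<inverse> u, u]\<close> is assumed.\<close>

definition positive_op :: "(('a::banach \<Rightarrow>\<^sub>L real) \<Rightarrow> 'a) \<Rightarrow> bool" where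
  "positive_op Q \<longleftrightarrow> (\<forall>\<phi>. 0 \<le> blinfun_apply \<phi> (Q \<phi>))"

definition inner_Q :: "(('a::banach \<Rightarrow>\<^sub>L real) \<Rightarrow> 'a) \<Rightarrow> 'a \<Rightarrow> 'a \<Rightarrow> real" where
  "inner_Q Q u v = blinfun_apply (inv Q u) v"

definition dual_norm :: "(('a::banach \<Rightarrow>\<^sub>L real) \<Rightarrow> 'a) \<Rightarrow> ('a \<Rightarrow>\<^sub>L real) \<Rightarrow> real" where
  "dual_norm Q \<phi> = sqrt (blinfun_apply \<phi> (Q \<phi>))"

text \<open>
  The dual of a subspace \<open>S\<close>: a bounded linear functional on \<open>S\<close> is represented by the function
  that agrees with it on \<open>S\<close> and is \<open>0\<close> off \<open>S\<close>, so that the vector space operations of the dual are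
  the pointwise ones. The value \<open>0\<close> off \<open>S\<close> is only a normal form, not a linear extension.
\<close>

definition dual_space :: "'a::real_normed_vector set \<Rightarrow> ('a \<Rightarrow> real) set" where
  "dual_space S = {f. (\<forall>x\<in>S. \<forall>y\<in>S. f (x + y) = f x + f y) \<and>
                      (\<forall>c. \<forall>x\<in>S. f (c *\<^sub>R x) = c * f x) \<and>
                      (\<exists>K. \<forall>x\<in>S. \<bar>f x\<bar> \<le> K * norm x) \<and>
                      (\<forall>x. x \<notin> S \<longrightarrow> f x = 0)}"

definition restrict_dual :: "'a::real_normed_vector set \<Rightarrow> ('a \<Rightarrow>\<^sub>L real) \<Rightarrow> 'a \<Rightarrow> real" where
  "restrict_dual S \<phi> = (\<lambda>x. if x \<in> S then blinfun_apply \<phi> x else 0)"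

text \<open>The point \<open>\<psi> = 0\<close> contributes \<open>0 / 0 = 0\<close>, which does not change the supremum unless
  \<open>S = {0}\<close>, where it gives the norm \<open>0\<close> of the zero functional.\<close>

definition dual_norm_on :: "'a::real_normed_vector set \<Rightarrow> ('a \<Rightarrow> real) \<Rightarrow> real" where
  "dual_norm_on S f = (SUP \<psi>\<in>S. f \<psi> / norm \<psi>)"

definition is_norm :: "('v::real_vector \<Rightarrow> real) \<Rightarrow> bool" where
  "is_norm N \<longleftrightarrow> (\<forall>f. 0 \<le> N f) \<and> (\<forall>f. N f = 0 \<longleftrightarrow> f = 0) \<and>
                 (\<forall>f g. N (f + g) \<le> N f + N g) \<and> (\<forall>c f. N (c *\<^sub>R f) = \<bar>c\<bar> * N f)"

definition is_norm_on_dual :: "'a::real_normed_vector set \<Rightarrow> (('a \<Rightarrow> real) \<Rightarrow> real) \<Rightarrow> bool" where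
  "is_norm_on_dual S N \<longleftrightarrow>
     (\<forall>f\<in>dual_space S. 0 \<le> N f) \<and>
     (\<forall>f\<in>dual_space S. N f = 0 \<longleftrightarrow> f = (\<lambda>x. 0)) \<and>
     (\<forall>f\<in>dual_space S. \<forall>g\<in>dual_space S. N (\<lambda>x. f x + g x) \<le> N f + N g) \<and>
     (\<forall>c. \<forall>f\<in>dual_space S. N (\<lambda>x. c * f x) = \<bar>c\<bar> * N f)"

text \<open>In the following, \<open>I\<close> and \<open>A\<close> are the index sets of \<open>i\<close> and \<open>\<alpha>\<close>.\<close>

definition independent_family ::
    "nat set \<Rightarrow> nat set \<Rightarrow> (nat \<Rightarrow> nat \<Rightarrow> ('a::real_normed_vector \<Rightarrow>\<^sub>L real)) \<Rightarrow> bool" where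
  "independent_family I A \<phi> \<longleftrightarrow>
     inj_on (\<lambda>(i, \<alpha>). \<phi> i \<alpha>) (I \<times> A) \<and> independent ((\<lambda>(i, \<alpha>). \<phi> i \<alpha>) ` (I \<times> A))"

definition Phi ::
    "nat set \<Rightarrow> nat set \<Rightarrow> (nat \<Rightarrow> nat \<Rightarrow> ('a::real_normed_vector \<Rightarrow>\<^sub>L real)) \<Rightarrow> ('a \<Rightarrow>\<^sub>L real) set" where
  "Phi I A \<phi> = span ((\<lambda>(i, \<alpha>). \<phi> i \<alpha>) ` (I \<times> A))"

definition V_perp ::
    "nat set \<Rightarrow> nat set \<Rightarrow> (nat \<Rightarrow> nat \<Rightarrow> ('a::real_normed_vector \<Rightarrow>\<^sub>L real)) \<Rightarrow> 'a set" where
  "V_perp I A \<phi> = {\<psi>. \<forall>i\<in>I. \<forall>\<alpha>\<in>A. blinfun_apply (\<phi> i \<alpha>) \<psi> = 0}"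

definition orth_proj :: "(('a::banach \<Rightarrow>\<^sub>L real) \<Rightarrow> 'a) \<Rightarrow> 'a set \<Rightarrow> 'a \<Rightarrow> 'a" where
  "orth_proj Q W u = (THE v. v \<in> W \<and> (\<forall>w\<in>W. inner_Q Q (u - v) w = 0))"

definition proj_sum ::
    "(('a::banach \<Rightarrow>\<^sub>L real) \<Rightarrow> 'a) \<Rightarrow> nat set \<Rightarrow> nat set \<Rightarrow>
     (nat \<Rightarrow> nat \<Rightarrow> ('a \<Rightarrow>\<^sub>L real)) \<Rightarrow> (nat \<Rightarrow> 'a set) \<Rightarrow> 'a \<Rightarrow> 'a" where
  "proj_sum Q I A \<phi> B u = (\<Sum>i\<in>I. orth_proj Q (B i \<inter> V_perp I A \<phi>) u)"

text \<open>
  The largest and smallest constants are taken in the extended reals only so that the degenerate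
  case \<open>V = {0}\<close>, in which every constant qualifies, needs no separate hypothesis (the values are
  then \<open>\<infinity>\<close> and \<open>-\<infinity>\<close>).
\<close>

definition lambda_min ::
    "(('a::banach \<Rightarrow>\<^sub>L real) \<Rightarrow> 'a) \<Rightarrow> 'a set \<Rightarrow> ('a \<Rightarrow> 'a) \<Rightarrow> ereal" where
  "lambda_min Q V P =
     (GREATEST l. \<forall>u\<in>V. l * ereal ((norm u)\<^sup>2) \<le> ereal (inner_Q Q u (P u)))"

definition lambda_max ::
    "(('a::banach \<Rightarrow>\<^sub>L real) \<Rightarrow> 'a) \<Rightarrow> 'a set \<Rightarrow> ('a \<Rightarrow> 'a) \<Rightarrow> ereal" where
  "lambda_max Q V P =
     (LEAST l. \<forall>u\<in>V. ereal (inner_Q Q u (P u)) \<le> l * ereal ((norm u)\<^sup>2))"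

end

theory Submission
  imports Defs
begin

text \<open>
  For \<open>u \<in> \<VV>\<^sup>\<bottom>\<close> and \<open>\<eta> = Q\<inverse> u\<close>, the distance of \<open>\<eta>\<close> from \<open>\<Phi>\<close> in the dual norm is \<open>\<parallel>u\<parallel>\<close>, and the
  distance of \<open>\<R>\<^sub>i \<eta>\<close> from \<open>\<R>\<^sub>i \<Phi>\<close> in the dual norm of \<open>\<B>\<^sub>i\<close> is \<open>\<parallel>P\<^sub>i u\<parallel>\<close>: testing with \<open>P\<^sub>i u\<close> gives one
  inequality, and the functional \<open>\<langle>u - P\<^sub>i u, \<cdot>\<rangle>\<close>, which vanishes on \<open>\<B>\<^sub>i \<inter> \<VV>\<^sup>\<bottom>\<close>, agrees on \<open>\<B>\<^sub>i\<close> with an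
  element of the finite-dimensional space \<open>\<Phi>\<close>, which gives the other. Since
  \<open>\<langle>u, P u\<rangle> = \<Sum>\<^sub>i \<parallel>P\<^sub>i u\<parallel>\<^sup>2\<close>, the hypothesis applied to \<open>\<eta>\<close> compares \<open>\<langle>u, P u\<rangle>\<close> with \<open>\<parallel>u\<parallel>\<^sup>2\<close>; the two
  changes of norm cost a factor \<open>C\<^sub>e\<^sup>2\<close> each.
\<close>

section \<open>Functionals on subspaces and their dual norms\<close>

text \<open>Induction on \<open>F\<close>, with \<open>S\<close> kept arbitrary because each step
  shrinks it to the kernel of \<open>f\<close>: there \<open>g\<close> agrees with the inductive
  \<open>h\<close>, so on \<open>S\<close> the difference of \<open>g\<close> and \<open>h\<close>
  is a multiple of \<open>f\<close>.\<close>

lemma functional_eq_on_subspace_span: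
  fixes g :: "'a::real_normed_vector \<Rightarrow>\<^sub>L real"
  assumes "finite F" and "subspace S"
    and "\<And>x. x \<in> S \<Longrightarrow> (\<forall>f\<in>F. blinfun_apply f x = 0) \<Longrightarrow> blinfun_apply g x = 0"
  shows "\<exists>h\<in>span F. \<forall>x\<in>S. blinfun_apply g x = blinfun_apply h x"
  using assms
proof (induction F arbitrary: S rule: finite_induct)
  case empty
  then show ?case by (intro bexI[of _ 0]) auto
next
  case (insert f F)
  let ?S = "S \<inter> {x. blinfun_apply f x = 0}"
  have "subspace ?S"
    using insert.prems(1) by (auto simp: subspace_def blinfun.add_right blinfun.scaleR_right)
  moreover have "blinfun_apply g x = 0" if "x \<in> ?S" "\<forall>f\<in>F. blinfun_apply f x = 0" for x
    using insert.prems(2)[of x] that by auto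
  ultimately obtain h where h: "h \<in> span F" and gh: "\<And>x. x \<in> ?S \<Longrightarrow> blinfun_apply g x = blinfun_apply h x"
    using insert.IH[of ?S] by blast
  have h': "h \<in> span (insert f F)"
    using h span_mono[of F "insert f F"] by blast
  show ?case
  proof (cases "\<forall>x\<in>S. blinfun_apply f x = 0")
    case True
    then show ?thesis using gh h' by (intro bexI[of _ h]) auto
  next
    case False
    then obtain z where z: "z \<in> S" "blinfun_apply f z \<noteq> 0" by blast
    \<comment> \<open>\<open>c\<close> makes \<open>h + c *\<^sub>R f\<close> agree with
      \<open>g\<close> at \<open>z\<close>; \<open>S\<close> is spanned by \<open>?S\<close>
      together with \<open>z\<close>.\<close>
    define c where "c = (blinfun_apply g z - blinfun_apply h z) / blinfun_apply f z"
    have "blinfun_apply g x = blinfun_apply (h + c *\<^sub>R f) x" if x: "x \<in> S" for x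
    proof -
      define t where "t = blinfun_apply f x / blinfun_apply f z"
      have "x - t *\<^sub>R z \<in> ?S"
        using x z insert.prems(1)
        by (auto simp: t_def blinfun.diff_right blinfun.scaleR_right subspace_diff subspace_scale)
      from gh[OF this] show ?thesis
        using z by (simp add: t_def c_def blinfun.diff_right blinfun.scaleR_right blinfun.add_left
            blinfun.scaleR_left field_simps)
    qed
    moreover have "h + c *\<^sub>R f \<in> span (insert f F)"
      by (intro span_add[OF h'] span_scale span_base) simp
    ultimately show ?thesis by blast
  qed
qed

lemma restrict_dual_in_dual_space:
  assumes "subspace S"
  shows "restrict_dual S \<eta> \<in> dual_space S"
proof -
  have "\<forall>x\<in>S. \<bar>blinfun_apply \<eta> x\<bar> \<le> norm \<eta> * norm x"
    using norm_blinfun[of \<eta>] by auto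
  then show ?thesis
    using assms by (auto simp: restrict_dual_def dual_space_def subspace_add subspace_scale
        blinfun.add_right blinfun.scaleR_right)
qed

lemma dual_norm_on_ge:
  assumes "\<psi> \<in> S"
  shows "blinfun_apply \<eta> \<psi> / norm \<psi> \<le> dual_norm_on S (restrict_dual S \<eta>)"
proof -
  \<comment> \<open>A real supremum is an upper bound only of a bounded set; the operator norm of
    \<open>\<eta>\<close> on the whole space provides the bound.\<close>
  have "restrict_dual S \<eta> x / norm x \<le> norm \<eta>" for x
    using norm_blinfun[of \<eta> x] by (cases "x = 0") (auto simp: restrict_dual_def field_simps)
  then have "bdd_above ((\<lambda>\<psi>. restrict_dual S \<eta> \<psi> / norm \<psi>) ` S)"
    by (intro bdd_aboveI2)
  from cSUP_upper[OF assms this] show ?thesis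
    using assms by (simp add: dual_norm_on_def restrict_dual_def)
qed

lemma dual_norm_on_le:
  assumes "S \<noteq> {}" and "C \<ge> 0"
    and "\<And>\<psi>. \<psi> \<in> S \<Longrightarrow> f \<psi> \<le> C * norm \<psi>"
  shows "dual_norm_on S f \<le> C"
  unfolding dual_norm_on_def
proof (rule cSUP_least[OF assms(1)])
  fix \<psi> assume "\<psi> \<in> S"
  \<comment> \<open>At \<open>\<psi> = 0\<close> the quotient is 0, and the claim is
    \<open>0 \<le> C\<close>.\<close>
  then show "f \<psi> / norm \<psi> \<le> C"
    using assms(2,3) by (cases "\<psi> = 0") (auto simp: field_simps)
qed

lemma V_perp_annihilates_Phi:
  assumes "u \<in> V_perp I A \<phi>" and "\<zeta> \<in> Phi I A \<phi>"
  shows "blinfun_apply \<zeta> u = 0"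
  using assms(2) unfolding Phi_def
proof (induction rule: span_induct_alt)
  case (step c x y)
  then show ?case
    using assms(1) by (auto simp: V_perp_def blinfun.add_left blinfun.scaleR_left)
qed simp

lemma subspace_V_perp: "subspace (V_perp I A \<phi>)"
  by (auto simp: V_perp_def subspace_def blinfun.add_right blinfun.scaleR_right)

lemma closed_V_perp: "closed (V_perp I A \<phi>)"
proof -
  have "V_perp I A \<phi> = (\<Inter>i\<in>I. \<Inter>\<alpha>\<in>A. {\<psi>. blinfun_apply (\<phi> i \<alpha>) \<psi> = 0})"
    by (auto simp: V_perp_def)
  also have "closed \<dots>"
    by (intro closed_INT ballI closed_Collect_eq continuous_intros)
  finally show ?thesis .
qed

section \<open>The Hilbert space structure given by \<open>Q\<close>\<close>

text \<open>These properties make \<open>inner_Q Q\<close> an inner product inducing the norm of the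
  type; its definiteness is read off from \<open>norm_sq\<close>.\<close>

locale quadratic_norm =
  fixes Q :: "('a::banach \<Rightarrow>\<^sub>L real) \<Rightarrow> 'a"
  assumes linear_Q: "linear Q" and bij_Q: "bij Q" and symmetric_Q: "symmetric_op Q"
    and norm_sq: "\<And>u :: 'a. (norm u)\<^sup>2 = blinfun_apply (inv Q u) u"
begin

lemma Q_inv [simp]: "Q (inv Q u) = u"
  using bij_Q by (simp add: bij_is_surj surj_f_inv_f)

lemma inv_Q [simp]: "inv Q (Q \<eta>) = \<eta>"
  using bij_Q by (simp add: bij_is_inj)

lemma linear_inv_Q: "linear (inv Q)"
proof (rule linearI)
  show "inv Q (x + y) = inv Q x + inv Q y" for x y
    using linear_add[OF linear_Q, of "inv Q x" "inv Q y"] by (metis Q_inv inv_Q)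
  show "inv Q (c *\<^sub>R x) = c *\<^sub>R inv Q x" for c x
    using linear_scale[OF linear_Q, of c "inv Q x"] by (metis Q_inv inv_Q)
qed

lemma inner_commute: "inner_Q Q u v = inner_Q Q v u"
  using symmetric_Q unfolding symmetric_op_def inner_Q_def by (metis Q_inv)

lemma inner_self: "inner_Q Q u u = (norm u)\<^sup>2"
  by (simp add: inner_Q_def norm_sq)

lemma inner_right:
  "inner_Q Q u (v + w) = inner_Q Q u v + inner_Q Q u w"
  "inner_Q Q u (v - w) = inner_Q Q u v - inner_Q Q u w"
  "inner_Q Q u (c *\<^sub>R v) = c * inner_Q Q u v"
  "inner_Q Q u (sum f K) = (\<Sum>k\<in>K. inner_Q Q u (f k))"
  "inner_Q Q u 0 = 0"
  by (simp_all add: inner_Q_def blinfun.add_right blinfun.diff_right blinfun.scaleR_right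
      blinfun.sum_right)

lemma inner_left:
  "inner_Q Q (v + w) u = inner_Q Q v u + inner_Q Q w u"
  "inner_Q Q (v - w) u = inner_Q Q v u - inner_Q Q w u"
  "inner_Q Q (c *\<^sub>R v) u = c * inner_Q Q v u"
  by (simp_all add: inner_right inner_commute[of _ u])

lemma norm_add_sq: "(norm (u + v))\<^sup>2 = (norm u)\<^sup>2 + 2 * inner_Q Q u v + (norm v)\<^sup>2"
  by (simp add: inner_self[symmetric] inner_left inner_right inner_commute[of v u])

lemma norm_diff_sq: "(norm (u - v))\<^sup>2 = (norm u)\<^sup>2 - 2 * inner_Q Q u v + (norm v)\<^sup>2"
  by (simp add: inner_self[symmetric] inner_left inner_right inner_commute[of v u])

lemma parallelogram:
  fixes u v :: 'a
  shows "(norm (u + v))\<^sup>2 + (norm (u - v))\<^sup>2 = 2 * (norm u)\<^sup>2 + 2 * (norm v)\<^sup>2"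
  by (simp add: norm_add_sq norm_diff_sq)

text \<open>The norm already satisfies the triangle inequality, so the usual derivation is reversed:
  square it and compare cross terms.\<close>

lemma Cauchy_Schwarz: "inner_Q Q u v \<le> norm u * norm v"
proof -
  have "(norm (u + v))\<^sup>2 \<le> (norm u + norm v)\<^sup>2"
    by (intro power_mono norm_triangle_ineq) auto
  then show ?thesis by (simp add: norm_add_sq power2_sum)
qed

text \<open>\<open>Q\<close> is an isometry for the dual norm, so distances in the dual can be
  computed in the space itself.\<close>

lemma dual_norm_eq: "dual_norm Q \<eta> = norm (Q \<eta>)"
  using norm_sq[of "Q \<eta>"] by (simp add: dual_norm_def real_sqrt_unique)

section \<open>Orthogonal projection onto closed subspaces\<close>

text \<open>A minimising sequence is Cauchy by the parallelogram law; completeness and closedness of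
  \<open>W\<close> give the minimiser.\<close>

lemma nearest_point_exists:
  fixes u :: 'a
  assumes W: "subspace W" "closed W"
  shows "\<exists>v\<in>W. \<forall>w\<in>W. norm (u - v) \<le> norm (u - w)"
proof -
  have ne: "W \<noteq> {}" using W subspace_0 by blast
  define d where "d = (INF w\<in>W. (norm (u - w))\<^sup>2)"
  have bdd: "bdd_below ((\<lambda>w. (norm (u - w))\<^sup>2) ` W)"
    by (intro bdd_belowI[of _ 0]) auto
  have d_le: "d \<le> (norm (u - w))\<^sup>2" if "w \<in> W" for w
    unfolding d_def using cINF_lower[OF bdd that] by simp
  have "\<exists>w\<in>W. (norm (u - w))\<^sup>2 < d + inverse (real (Suc n))" for n
    using cInf_lessD[of "(\<lambda>w. (norm (u - w))\<^sup>2) ` W" "d + inverse (real (Suc n))"] ne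
    by (auto simp: d_def)
  then obtain w where wW: "\<And>n. w n \<in> W"
    and w: "\<And>n. (norm (u - w n))\<^sup>2 < d + inverse (real (Suc n))" by metis
  have gap: "(norm (w m - w n))\<^sup>2 \<le> 2 * inverse (real (Suc m)) + 2 * inverse (real (Suc n))" for m n
  proof -
    \<comment> \<open>The midpoint of \<open>w m\<close> and \<open>w n\<close> lies in
      \<open>W\<close>, so the parallelogram law bounds their gap by twice the sum of the excesses
      of the two squared distances over \<open>d\<close>.\<close>
    have "d \<le> (norm (u - (1/2) *\<^sub>R (w m + w n)))\<^sup>2"
      by (intro d_le subspace_scale subspace_add W wW)
    moreover have "(u - w m) + (u - w n) = 2 *\<^sub>R (u - (1/2) *\<^sub>R (w m + w n))"
      by (simp add: algebra_simps scaleR_2)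
    then have "(norm ((u - w m) + (u - w n)))\<^sup>2 = 4 * (norm (u - (1/2) *\<^sub>R (w m + w n)))\<^sup>2"
      by (simp add: power_mult_distrib)
    moreover have "(u - w m) - (u - w n) = w n - w m" by simp
    ultimately show ?thesis
      using parallelogram[of "u - w m" "u - w n"] w[of m] w[of n]
      by (simp add: norm_minus_commute[of "w n"])
  qed
  have "Cauchy w"
  proof (rule metric_CauchyI)
    fix e :: real assume "0 < e"
    \<comment> \<open>From \<open>N\<close> on, the bound in \<open>gap\<close> is at most
      \<open>4 * inverse (real (Suc N))\<close>, hence the quarter.\<close>
    then obtain N where N: "inverse (real (Suc N)) < e\<^sup>2 / 4"
      using reals_Archimedean[of "e\<^sup>2 / 4"] by auto
    have "dist (w m) (w n) < e" if "m \<ge> N" "n \<ge> N" for m n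
    proof -
      have "inverse (real (Suc m)) \<le> inverse (real (Suc N))"
        "inverse (real (Suc n)) \<le> inverse (real (Suc N))"
        using that by (auto intro!: le_imp_inverse_le)
      then have "(norm (w m - w n))\<^sup>2 < e\<^sup>2" using gap[of m n] N by linarith
      then show ?thesis using \<open>0 < e\<close> by (simp add: dist_norm power_less_imp_less_base)
    qed
    then show "\<exists>N. \<forall>m\<ge>N. \<forall>n\<ge>N. dist (w m) (w n) < e" by blast
  qed
  then obtain v where v: "w \<longlonglongrightarrow> v"
    using Cauchy_convergent_iff convergent_def by blast
  have "v \<in> W" using closed_sequentially[OF W(2) wW v] .
  have "(\<lambda>n. (norm (u - w n))\<^sup>2) \<longlonglongrightarrow> (norm (u - v))\<^sup>2"
    by (intro tendsto_intros v)
  moreover have "(\<lambda>n. d + inverse (real (Suc n))) \<longlonglongrightarrow> d + 0"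
    by (intro tendsto_intros LIMSEQ_inverse_real_of_nat)
  ultimately have "(norm (u - v))\<^sup>2 \<le> d + 0"
    using w by (intro LIMSEQ_le[of _ _ "\<lambda>n. d + inverse (real (Suc n))"]) (auto intro: less_imp_le)
  then have "(norm (u - v))\<^sup>2 \<le> d" by simp
  then have "norm (u - v) \<le> norm (u - x)" if "x \<in> W" for x
    using d_le[OF that] by (meson order_trans power2_le_imp_le norm_ge_zero)
  with \<open>v \<in> W\<close> show ?thesis by blast
qed

lemma nearest_point_orthogonal:
  assumes W: "subspace W" and v: "v \<in> W" and min: "\<And>w. w \<in> W \<Longrightarrow> norm (u - v) \<le> norm (u - w)"
    and w: "w \<in> W"
  shows "inner_Q Q (u - v) w = 0"
proof (cases "w = 0")
  case True
  then show ?thesis by (simp add: inner_right)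
next
  case False
  \<comment> \<open>Moving \<open>v\<close> by \<open>t *\<^sub>R w\<close> would lower the squared
    distance by exactly \<open>t\<^sup>2 * (norm w)\<^sup>2\<close>, so minimality forces
    \<open>t = 0\<close>.\<close>
  define t where "t = inner_Q Q (u - v) w / (norm w)\<^sup>2"
  have "norm (u - v) \<le> norm (u - (v + t *\<^sub>R w))"
    by (intro min subspace_add subspace_scale W v w)
  then have "(norm (u - v))\<^sup>2 \<le> (norm ((u - v) - t *\<^sub>R w))\<^sup>2"
    by (intro power_mono) (auto simp: algebra_simps)
  then have "2 * (t * inner_Q Q (u - v) w) \<le> t\<^sup>2 * (norm w)\<^sup>2"
    by (simp add: norm_diff_sq[of "u - v"] inner_right power_mult_distrib)
  moreover have ip: "inner_Q Q (u - v) w = t * (norm w)\<^sup>2" using False by (simp add: t_def)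
  ultimately have "t\<^sup>2 * (norm w)\<^sup>2 \<le> 0" by (simp add: power2_eq_square)
  then have "t = 0" using False by (simp add: mult_le_0_iff)
  then show ?thesis using ip by simp
qed

text \<open>Unfolds the definite description: a nearest point is a candidate, and the difference of
  two candidates lies in \<open>W\<close> and is orthogonal to itself.\<close>

lemma orth_proj:
  assumes W: "subspace W" "closed W"
  shows "orth_proj Q W u \<in> W" and "\<And>w. w \<in> W \<Longrightarrow> inner_Q Q (u - orth_proj Q W u) w = 0"
proof -
  let ?R = "\<lambda>v. v \<in> W \<and> (\<forall>w\<in>W. inner_Q Q (u - v) w = 0)"
  have "\<exists>v. ?R v"
    using nearest_point_exists[OF W, of u] nearest_point_orthogonal[OF W(1)] by blast
  moreover have "x = y" if "?R x" "?R y" for x y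
  proof -
    have "x - y \<in> W" using that W by (auto intro: subspace_diff)
    then have "inner_Q Q (u - y) (x - y) = 0" "inner_Q Q (u - x) (x - y) = 0" using that by auto
    then have "inner_Q Q (x - y) (x - y) = 0" by (simp add: inner_left inner_right)
    then show ?thesis by (simp add: inner_self)
  qed
  ultimately have "\<exists>!v. ?R v" by blast
  then have "?R (orth_proj Q W u)"
    unfolding orth_proj_def by (rule theI')
  then show "orth_proj Q W u \<in> W" and "\<And>w. w \<in> W \<Longrightarrow> inner_Q Q (u - orth_proj Q W u) w = 0"
    by blast+
qed

lemma inner_orth_proj:
  assumes "subspace W" "closed W"
  shows "inner_Q Q u (orth_proj Q W u) = (norm (orth_proj Q W u))\<^sup>2"
  using orth_proj(2)[OF assms orth_proj(1)[OF assms], of u u]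
  by (simp add: inner_left inner_self)

section \<open>Distances from \<open>Phi\<close> in the dual norms\<close>

lemma dual_dist_Phi_ge:
  assumes "u \<in> V_perp I A \<phi>" and "\<zeta> \<in> Phi I A \<phi>"
  shows "norm u \<le> dual_norm Q (inv Q u - \<zeta>)"
proof -
  \<comment> \<open>\<open>Q\<close> maps \<open>Phi\<close> into the orthogonal complement of
    \<open>V_perp\<close>, so Pythagoras applies to \<open>u - Q \<zeta>\<close>.\<close>
  have "inner_Q Q u (Q \<zeta>) = 0"
    using V_perp_annihilates_Phi[OF assms] inner_commute[of u "Q \<zeta>"] by (simp add: inner_Q_def)
  then have "(norm u)\<^sup>2 \<le> (norm (u - Q \<zeta>))\<^sup>2"
    by (simp add: norm_diff_sq)
  then have "norm u \<le> norm (u - Q \<zeta>)"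
    by (rule power2_le_imp_le) simp
  then show ?thesis
    by (simp add: dual_norm_eq linear_diff[OF linear_Q])
qed

lemma restricted_dual_dist_Phi_ge:
  assumes S: "subspace S" "closed S" and \<zeta>: "\<zeta> \<in> Phi I A \<phi>"
  shows "norm (orth_proj Q (S \<inter> V_perp I A \<phi>) u)
    \<le> dual_norm_on S (restrict_dual S (inv Q u - \<zeta>))"
proof -
  let ?W = "S \<inter> V_perp I A \<phi>"
  let ?p = "orth_proj Q ?W u"
  have W: "subspace ?W" "closed ?W"
    using S by (auto intro: subspace_inter subspace_V_perp closed_V_perp)
  have p: "?p \<in> ?W" using orth_proj(1)[OF W] .
  then have "blinfun_apply (inv Q u - \<zeta>) ?p = (norm ?p)\<^sup>2"
    using V_perp_annihilates_Phi[OF _ \<zeta>, of ?p] inner_orth_proj[OF W, of u]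
    by (simp add: blinfun.diff_left inner_Q_def)
  \<comment> \<open>Dividing by \<open>norm ?p\<close> gives the bound; for \<open>?p = 0\<close>
    the quotient \<open>0 / 0 = 0\<close> still equals \<open>norm ?p\<close>.\<close>
  then show ?thesis
    using dual_norm_on_ge[of ?p S "inv Q u - \<zeta>"] p by (simp add: power2_eq_square split: if_splits)
qed

lemma restricted_dual_dist_Phi_attained:
  assumes S: "subspace S" "closed S" and fin: "finite I" "finite A"
  shows "\<exists>\<zeta>\<in>Phi I A \<phi>. dual_norm_on S (restrict_dual S (inv Q u - \<zeta>))
    \<le> norm (orth_proj Q (S \<inter> V_perp I A \<phi>) u)"
proof -
  let ?W = "S \<inter> V_perp I A \<phi>"
  let ?p = "orth_proj Q ?W u"
  have W: "subspace ?W" "closed ?W"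
    using S by (auto intro: subspace_inter subspace_V_perp closed_V_perp)
  have "\<exists>h\<in>span ((\<lambda>(i, \<alpha>). \<phi> i \<alpha>) ` (I \<times> A)).
      \<forall>x\<in>S. blinfun_apply (inv Q (u - ?p)) x = blinfun_apply h x"
  proof (rule functional_eq_on_subspace_span)
    fix x assume "x \<in> S" "\<forall>f\<in>(\<lambda>(i, \<alpha>). \<phi> i \<alpha>) ` (I \<times> A). blinfun_apply f x = 0"
    then have "x \<in> ?W" by (auto simp: V_perp_def)
    from orth_proj(2)[OF W this, of u] show "blinfun_apply (inv Q (u - ?p)) x = 0"
      by (simp add: inner_Q_def)
  qed (use fin S in auto)
  then obtain \<zeta> where \<zeta>: "\<zeta> \<in> Phi I A \<phi>"
    and eq: "\<And>x. x \<in> S \<Longrightarrow> blinfun_apply (inv Q (u - ?p)) x = blinfun_apply \<zeta> x"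
    unfolding Phi_def by blast
  have "dual_norm_on S (restrict_dual S (inv Q u - \<zeta>)) \<le> norm ?p"
  proof (rule dual_norm_on_le)
    show "S \<noteq> {}" using S subspace_0 by blast
    fix x assume x: "x \<in> S"
    \<comment> \<open>\<open>inv Q u\<close> is the sum of \<open>inv Q ?p\<close> and
      \<open>inv Q (u - ?p)\<close>; on \<open>S\<close> the second summand is cancelled by
      \<open>\<zeta>\<close>.\<close>
    then have "restrict_dual S (inv Q u - \<zeta>) x = inner_Q Q ?p x"
      using eq[OF x] by (simp add: restrict_dual_def inner_Q_def blinfun.diff_left
          linear_diff[OF linear_inv_Q])
    then show "restrict_dual S (inv Q u - \<zeta>) x \<le> norm ?p * norm x"
      using Cauchy_Schwarz[of ?p x] by simp
  qed simp
  with \<zeta> show ?thesis by blast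
qed

section \<open>Extremal constants as extrema of Rayleigh quotients\<close>

lemma inner_zero_left: "inner_Q Q 0 x = 0"
  using inner_left(3)[of 0 0 x] by simp

text \<open>The admissible constants form the down-set of the infimum \<open>L\<close> of the
  Rayleigh quotients, so the greatest one exists and is \<open>L\<close>, also when \<open>V\<close>
  has no nonzero vector and \<open>L\<close> is infinite.\<close>

lemma lambda_min_ge:
  assumes "\<And>u. u \<in> V \<Longrightarrow> c * (norm u)\<^sup>2 \<le> inner_Q Q u (P u)"
  shows "ereal c \<le> lambda_min Q V P"
proof -
  define L where "L = (INF u\<in>V - {0}. ereal (inner_Q Q u (P u) / (norm u)\<^sup>2))"
  have iff: "(\<forall>u\<in>V. l * ereal ((norm u)\<^sup>2) \<le> ereal (inner_Q Q u (P u))) \<longleftrightarrow> l \<le> L" for l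
  proof -
    \<comment> \<open>At \<open>u = 0\<close> both sides are 0 even for infinite \<open>l\<close>,
      because infinity times 0 is 0 in \<open>ereal\<close>.\<close>
    have "l * ereal ((norm u)\<^sup>2) \<le> ereal (inner_Q Q u (P u)) \<longleftrightarrow>
        u = 0 \<or> l \<le> ereal (inner_Q Q u (P u) / (norm u)\<^sup>2)" for u
      by (cases "u = 0"; cases l) (auto simp: inner_zero_left field_simps)
    then show ?thesis by (auto simp: L_def le_INF_iff)
  qed
  have "lambda_min Q V P = L"
    unfolding lambda_min_def iff by (rule Greatest_equality) auto
  moreover have "ereal c \<le> L"
    using assms iff[of "ereal c"] by simp
  ultimately show ?thesis by simp
qed

lemma lambda_max_le:
  assumes "\<And>u. u \<in> V \<Longrightarrow> inner_Q Q u (P u) \<le> c * (norm u)\<^sup>2"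
  shows "lambda_max Q V P \<le> ereal c"
proof -
  define L where "L = (SUP u\<in>V - {0}. ereal (inner_Q Q u (P u) / (norm u)\<^sup>2))"
  have iff: "(\<forall>u\<in>V. ereal (inner_Q Q u (P u)) \<le> l * ereal ((norm u)\<^sup>2)) \<longleftrightarrow> L \<le> l" for l
  proof -
    have "ereal (inner_Q Q u (P u)) \<le> l * ereal ((norm u)\<^sup>2) \<longleftrightarrow>
        u = 0 \<or> ereal (inner_Q Q u (P u) / (norm u)\<^sup>2) \<le> l" for u
      by (cases "u = 0"; cases l) (auto simp: inner_zero_left field_simps)
    then show ?thesis by (auto simp: L_def SUP_le_iff)
  qed
  have "lambda_max Q V P = L"
    unfolding lambda_max_def iff by (rule Least_equality) auto
  moreover have "L \<le> ereal c"
    using assms iff[of "ereal c"] by simp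
  ultimately show ?thesis by simp
qed

end

section \<open>Squared distances under a change of norm\<close>

lemma INF_sq_lower:
  fixes M N :: "'b \<Rightarrow> real"
  assumes "X \<noteq> {}" and "r \<ge> 0" and "c > 0"
    and "\<And>x. x \<in> X \<Longrightarrow> r \<le> N x" and "\<And>x. x \<in> X \<Longrightarrow> N x \<le> c * M x"
  shows "r\<^sup>2 \<le> c\<^sup>2 * (INF x\<in>X. (M x)\<^sup>2)"
proof -
  have "r\<^sup>2 / c\<^sup>2 \<le> (INF x\<in>X. (M x)\<^sup>2)"
  proof (rule cINF_greatest[OF assms(1)])
    fix x assume "x \<in> X"
    then have "r \<le> c * M x" using assms(4,5) order_trans by blast
    then have "r\<^sup>2 \<le> (c * M x)\<^sup>2" using assms(2) by (intro power_mono)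
    then show "r\<^sup>2 / c\<^sup>2 \<le> (M x)\<^sup>2"
      using assms(3) by (simp add: field_simps power_mult_distrib)
  qed
  then show ?thesis using assms(3) by (simp add: field_simps)
qed

text \<open>A single good point \<open>x\<close> bounds the infimum from above; this is where a
  point attaining the distance in the original norm enters.\<close>

lemma INF_sq_upper:
  fixes M :: "'b \<Rightarrow> real"
  assumes "x \<in> X" and "M x \<ge> 0" and "c > 0" and "inverse c * M x \<le> N" and "N \<le> r"
  shows "(INF x\<in>X. (M x)\<^sup>2) \<le> c\<^sup>2 * r\<^sup>2"
proof -
  have "M x \<le> c * N" using assms(3,4) by (simp add: field_simps)
  also have "\<dots> \<le> c * r" using assms(3,5) by simp
  finally have M: "M x \<le> c * r" .
  have "bdd_below ((\<lambda>x. (M x)\<^sup>2) ` X)" by (intro bdd_belowI[of _ 0]) auto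
  from cINF_lower[OF this assms(1)] have "(INF x\<in>X. (M x)\<^sup>2) \<le> (M x)\<^sup>2" .
  also have "\<dots> \<le> (c * r)\<^sup>2" by (intro power_mono M assms(2))
  finally show ?thesis by (simp add: power_mult_distrib)
qed

section \<open>Bounds for the extremal constants of \<open>P\<close>\<close>

theorem theorem6p12:
  fixes Q :: "('a::banach \<Rightarrow>\<^sub>L real) \<Rightarrow> 'a"
    and nI nA :: nat
    and I A :: "nat set"
    and \<phi> :: "nat \<Rightarrow> nat \<Rightarrow> ('a \<Rightarrow>\<^sub>L real)"
    and B :: "nat \<Rightarrow> 'a set"
    and norm_e :: "('a \<Rightarrow>\<^sub>L real) \<Rightarrow> real"
    and norm_ei :: "nat \<Rightarrow> ('a \<Rightarrow> real) \<Rightarrow> real"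
    and Ce Cmin Cmax :: real
  assumes "reflexive_space TYPE('a)"
    and "separable_space (euclidean :: 'a topology)"
    and "linear Q" and "bij Q" and "symmetric_op Q" and "positive_op Q"
    and "\<And>u :: 'a. (norm u)\<^sup>2 = blinfun_apply (inv Q u) u"
    and "I = {1..nI}" and "A = {1..nA}"
    and "independent_family I A \<phi>"
    and "\<And>i. i \<in> I \<Longrightarrow> subspace (B i) \<and> closed (B i)"
    and "\<And>u :: 'a. \<exists>v. (\<forall>i\<in>I. v i \<in> B i) \<and> u = (\<Sum>i\<in>I. v i)"
    and "\<And>i \<alpha>. i \<in> I \<Longrightarrow> \<alpha> \<in> A \<Longrightarrow>
           \<exists>\<psi>\<in>B i. \<forall>j\<in>I. \<forall>\<beta>\<in>A.
             blinfun_apply (\<phi> j \<beta>) \<psi> = (if i = j \<and> \<alpha> = \<beta> then 1 else 0)"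
    and "is_norm norm_e"
    and "\<And>i. i \<in> I \<Longrightarrow> is_norm_on_dual (B i) (norm_ei i)"
    and "Ce \<ge> 1"
    and "\<And>\<eta>. inverse Ce * norm_e \<eta> \<le> dual_norm Q \<eta> \<and> dual_norm Q \<eta> \<le> Ce * norm_e \<eta>"
    and "\<And>i f. i \<in> I \<Longrightarrow> f \<in> dual_space (B i) \<Longrightarrow>
           inverse Ce * norm_ei i f \<le> dual_norm_on (B i) f \<and>
           dual_norm_on (B i) f \<le> Ce * norm_ei i f"
    and "Cmin > 0" and "Cmax > 0"
    and "\<And>\<eta>. Cmin * (INF \<zeta>\<in>Phi I A \<phi>. (norm_e (\<eta> - \<zeta>))\<^sup>2)
             \<le> (\<Sum>i\<in>I. INF \<zeta>\<in>Phi I A \<phi>. (norm_ei i (restrict_dual (B i) (\<eta> - \<zeta>)))\<^sup>2)"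
    and "\<And>\<eta>. (\<Sum>i\<in>I. INF \<zeta>\<in>Phi I A \<phi>. (norm_ei i (restrict_dual (B i) (\<eta> - \<zeta>)))\<^sup>2)
             \<le> Cmax * (INF \<zeta>\<in>Phi I A \<phi>. (norm_e (\<eta> - \<zeta>))\<^sup>2)"
  shows "lambda_max Q (V_perp I A \<phi>) (proj_sum Q I A \<phi> B) \<le> ereal (Ce ^ 4 * Cmax) \<and>
         lambda_min Q (V_perp I A \<phi>) (proj_sum Q I A \<phi> B) \<ge> ereal (inverse (Ce ^ 4) * Cmin)"
proof -
  interpret quadratic_norm Q
    by (rule quadratic_norm.intro[OF assms(3,4,5,7)])
  have fin: "finite I" "finite A" using assms(8,9) by auto
  have Ce: "Ce > 0" using assms(16) by simp
  note B = assms(11)[THEN conjunct1] assms(11)[THEN conjunct2]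
  have zero: "0 \<in> Phi I A \<phi>" by (simp add: Phi_def span_zero)
  then have ne: "Phi I A \<phi> \<noteq> {}" by blast
  let ?p = "\<lambda>i. orth_proj Q (B i \<inter> V_perp I A \<phi>)"
  define De where "De = (\<lambda>\<eta>. INF \<zeta>\<in>Phi I A \<phi>. (norm_e (\<eta> - \<zeta>))\<^sup>2)"
  define Di where
    "Di = (\<lambda>i \<eta>. INF \<zeta>\<in>Phi I A \<phi>. (norm_ei i (restrict_dual (B i) (\<eta> - \<zeta>)))\<^sup>2)"
  have quad: "inner_Q Q u (proj_sum Q I A \<phi> B u) = (\<Sum>i\<in>I. (norm (?p i u))\<^sup>2)" for u
    unfolding proj_sum_def inner_right
    by (intro sum.cong refl inner_orth_proj subspace_inter closed_Int subspace_V_perp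
        closed_V_perp B)
  have e_low: "(norm u)\<^sup>2 \<le> Ce\<^sup>2 * De (inv Q u)" if "u \<in> V_perp I A \<phi>" for u
    unfolding De_def
    by (rule INF_sq_lower[where N = "\<lambda>\<zeta>. dual_norm Q (inv Q u - \<zeta>)"])
      (use ne Ce assms(17) dual_dist_Phi_ge[OF that] in auto)
  \<comment> \<open>The witness is \<open>\<zeta> = 0\<close>, since the dual norm of
    \<open>inv Q u\<close> is \<open>norm u\<close>.\<close>
  have e_up: "De (inv Q u) \<le> Ce\<^sup>2 * (norm u)\<^sup>2" for u
    unfolding De_def
    by (rule INF_sq_upper[where x = 0 and N = "dual_norm Q (inv Q u)"])
      (use zero Ce assms(14) assms(17)[of "inv Q u"] in \<open>auto simp: is_norm_def dual_norm_eq\<close>)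
  have i_low: "(norm (?p i u))\<^sup>2 \<le> Ce\<^sup>2 * Di i (inv Q u)" if "i \<in> I" for i u
    unfolding Di_def
    by (rule INF_sq_lower[where N = "\<lambda>\<zeta>. dual_norm_on (B i) (restrict_dual (B i) (inv Q u - \<zeta>))"])
      (use ne Ce assms(18)[OF that restrict_dual_in_dual_space[OF B(1)[OF that]]]
        restricted_dual_dist_Phi_ge[OF B[OF that]] in auto)
  have i_up: "Di i (inv Q u) \<le> Ce\<^sup>2 * (norm (?p i u))\<^sup>2" if i: "i \<in> I" for i u
  proof -
    obtain \<zeta> where \<zeta>: "\<zeta> \<in> Phi I A \<phi>" "dual_norm_on (B i) (restrict_dual (B i) (inv Q u - \<zeta>))
        \<le> norm (?p i u)"
      using restricted_dual_dist_Phi_attained[OF B[OF i] fin] by blast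
    \<comment> \<open>Membership is recorded because \<open>norm_ei i\<close> is known to be
      nonnegative and comparable only on \<open>dual_space (B i)\<close>.\<close>
    have ds: "restrict_dual (B i) (inv Q u - \<zeta>) \<in> dual_space (B i)"
      by (rule restrict_dual_in_dual_space[OF B(1)[OF i]])
    show ?thesis
      unfolding Di_def
      by (rule INF_sq_upper[where x = \<zeta>, OF \<zeta>(1) _ Ce _ \<zeta>(2)])
        (use assms(15)[OF i] assms(18)[OF i ds] ds in \<open>auto simp: is_norm_on_dual_def\<close>)
  qed
  have lower: "Cmin * De \<eta> \<le> (\<Sum>i\<in>I. Di i \<eta>)" and upper: "(\<Sum>i\<in>I. Di i \<eta>) \<le> Cmax * De \<eta>" for \<eta>
    using assms(21,22) by (simp_all add: De_def Di_def)
  have "lambda_max Q (V_perp I A \<phi>) (proj_sum Q I A \<phi> B) \<le> ereal (Ce ^ 4 * Cmax)"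
  proof (rule lambda_max_le)
    fix u assume "u \<in> V_perp I A \<phi>"
    \<comment> \<open>One factor \<open>Ce\<^sup>2\<close> comes from the local norms through
      \<open>i_low\<close>, the other from the global norm through \<open>e_up\<close>.\<close>
    have "inner_Q Q u (proj_sum Q I A \<phi> B u) \<le> Ce\<^sup>2 * (\<Sum>i\<in>I. Di i (inv Q u))"
      unfolding quad sum_distrib_left by (intro sum_mono i_low)
    also have "\<dots> \<le> Ce\<^sup>2 * (Cmax * (Ce\<^sup>2 * (norm u)\<^sup>2))"
      using assms(20) by (intro mult_left_mono order_trans[OF upper] e_up) auto
    also have "\<dots> = Ce ^ 4 * Cmax * (norm u)\<^sup>2"
      by (simp add: power2_eq_square power4_eq_xxxx)
    finally show "inner_Q Q u (proj_sum Q I A \<phi> B u) \<le> Ce ^ 4 * Cmax * (norm u)\<^sup>2" .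
  qed
  moreover have "ereal (inverse (Ce ^ 4) * Cmin) \<le> lambda_min Q (V_perp I A \<phi>) (proj_sum Q I A \<phi> B)"
  proof (rule lambda_min_ge)
    fix u assume u: "u \<in> V_perp I A \<phi>"
    \<comment> \<open>The chain runs in the opposite direction, through \<open>e_low\<close> and
      \<open>i_up\<close>; dividing by \<open>Ce ^ 4\<close> at the end gives the constant.\<close>
    have "Cmin * (norm u)\<^sup>2 \<le> Ce\<^sup>2 * (Cmin * De (inv Q u))"
      using mult_left_mono[OF e_low[OF u], of Cmin] assms(19) by (simp add: mult.left_commute)
    also have "\<dots> \<le> Ce\<^sup>2 * (\<Sum>i\<in>I. Di i (inv Q u))"
      by (intro mult_left_mono lower) auto
    also have "\<dots> \<le> Ce\<^sup>2 * (\<Sum>i\<in>I. Ce\<^sup>2 * (norm (?p i u))\<^sup>2)"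
      by (intro mult_left_mono sum_mono i_up) auto
    also have "\<dots> = Ce ^ 4 * inner_Q Q u (proj_sum Q I A \<phi> B u)"
      by (simp add: quad sum_distrib_left power2_eq_square power4_eq_xxxx mult.assoc)
    finally show "inverse (Ce ^ 4) * Cmin * (norm u)\<^sup>2 \<le> inner_Q Q u (proj_sum Q I A \<phi> B u)"
      using Ce by (simp add: field_simps)
  qed
  ultimately show ?thesis by simp
qed

end
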